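(* The following continuous embeddings of Lorentz-Herz spaces over a Lebesgue measurable set $\Omega\subset\mathbb R^N$ hold. (A) If $a\in\mathbb R$, $0<p<\infty$, $0<r_1\le r_2\le\infty$ and $0<q\le\infty$, then $HL^{p,r_1}_{a,q}\hookrightarrow HL^{p,r_2}_{a,q}$. (B) If $a_2\le a_1$ (real) and $0<p,q,r\le\infty$, then $HL^{p,r}_{a_1,q}\hookrightarrow HL^{p,r}_{a_2,q}$. (C) Suppose $\mu(\Omega)<\infty$. If $a\in\mathbb R$, $0<r_1,r_2\le\infty$, $0<q\le\infty$ and $0<p_1<p_2<\infty$, then $HL^{p_2,r_2}_{a,q}\hookrightarrow HL^{p_1,r_1}_{a,q}$. (D) If $a\in\mathbb R$, $0<r_1,r_2\le\infty$, $0<q\le\infty$ and $0<p_1<p_2<\infty$, then $HL^{p_2,r_2}_{a+Np_0,q}\hookrightarrow HL^{p_1,r_1}_{a,q}$, where $p_0=\frac1{p_1}-\frac1{p_2}>0$. (E) If $a\in\mathbb R$, $0<p,r\le\infty$ and $0<q_2\le q_1\le\infty$, then $HL^{p,r}_{a,q_2}\hookrightarrow HL^{p,r}_{a,q_1}$.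
   Context: $\mu$ is Lebesgue measure. For measurable $f$ let $f^*(t)=\inf\{\lambda>0:\mu(\{|f|>\lambda\})\le t\}$. Put $\|f\|_{p,r}=\left(\int_0^\infty(t^{1/p}f^*(t))^r\frac{dt}t\right)^{1/r}$ for $0<p,r<\infty$ and $\|f\|_{p,\infty}=\sup_{t>0}t^{1/p}f^*(t)$ for $0<p\le\infty$; $L^{p,r}(A)$ is the space of measurable functions on $A$ with finite $\|\cdot\|_{p,r}$. It is always assumed that $r=\infty$ if $p=\infty$. Let $I=\{-1,0,1,2,\dots\}$, $\Omega_{-1}=\{\omega\in\Omega:|\omega|<1/2\}$, $\Omega_k=\{\omega\in\Omega:2^{k-1}\le|\omega|<2^k\}$ for $k\ge0$. $HL^{p,r}_{a,q}$ consists of the measurable $f$ on $\Omega$ with $f\chi_{\Omega_k}\in L^{p,r}(\Omega_k)$ for all $k\in I$ and $\|f\|_{HL^{p,r}_{a,q}}=\left(\sum_{k\in I}2^{kaq}\|f\chi_{\Omega_k}\|_{p,r}^q\right)^{1/q}<\infty$ ($\sup_k2^{ka}\|f\chi_{\Omega_k}\|_{p,r}$ if $q=\infty$). $E\hookrightarrow F$ means $E\subset F$ and $\|x\|_F\le C\|x\|_E$ for all $x\in E$ with some constant $C>0$. *)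

theory Defs
  imports "HOL-Analysis.Analysis"
begin

text \<open>Real powers of extended nonnegative reals. Only positive exponents are used, so that
  \<open>0\<close> and \<open>\<infinity>\<close> are both fixed.\<close>

definition epowr :: "ennreal \<Rightarrow> real \<Rightarrow> ennreal" where
  "epowr x s = (if x = \<infinity> then \<infinity> else ennreal (enn2real x powr s))"

text \<open>The infimum is taken in \<open>[0,\<infinity>]\<close>, so that it is \<open>\<infinity>\<close> when no \<open>s\<close> qualifies.\<close>

definition decr_rearr ::
  "'a measure \<Rightarrow> ('a \<Rightarrow> 'b::real_normed_vector) \<Rightarrow> real \<Rightarrow> ennreal" where
  "decr_rearr M f t =
     (INF s\<in>{s::real. 0 < s \<and> emeasure M {x \<in> space M. s < norm (f x)} \<le> ennreal t}. ennreal s)"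

text \<open>The exponents range over \<open>(0,\<infinity>]\<close>; \<open>enn2real (1 / p)\<close> is the real number \<open>1/p\<close>, with
  \<open>1/\<infinity> = 0\<close>. The value for \<open>p = \<infinity>\<close>, \<open>r < \<infinity>\<close> is irrelevant: this combination is
  excluded wherever the functional is used.\<close>

definition lorentz_norm ::
  "'a measure \<Rightarrow> ennreal \<Rightarrow> ennreal \<Rightarrow> ('a \<Rightarrow> 'b::real_normed_vector) \<Rightarrow> ennreal" where
  "lorentz_norm M p r f =
     (if r = \<infinity> then (SUP t\<in>{0<..}. ennreal (t powr enn2real (1 / p)) * decr_rearr M f t)
      else epowr
        (\<integral>\<^sup>+t\<in>{0<..}. (epowr (ennreal (t powr enn2real (1 / p)) * decr_rearr M f t) (enn2real r)
             * ennreal (1 / t)) \<partial>lborel)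
        (1 / enn2real r))"

definition lorentz_space ::
  "'a measure \<Rightarrow> ennreal \<Rightarrow> ennreal \<Rightarrow> ('a \<Rightarrow> 'b::real_normed_vector) set" where
  "lorentz_space M p r = {f \<in> borel_measurable M. lorentz_norm M p r f < \<infinity>}"

definition shell :: "'a::euclidean_space set \<Rightarrow> int \<Rightarrow> 'a set" where
  "shell \<Omega> k =
     (if k = -1 then {\<omega> \<in> \<Omega>. norm \<omega> < 1 / 2}
      else {\<omega> \<in> \<Omega>. 2 powr (of_int k - 1) \<le> norm \<omega> \<and> norm \<omega> < 2 powr (of_int k)})"

definition cutoff ::
  "'a::euclidean_space set \<Rightarrow> int \<Rightarrow> ('a \<Rightarrow> 'b::real_normed_vector) \<Rightarrow> 'a \<Rightarrow> 'b" where
  "cutoff \<Omega> k f = (\<lambda>\<omega>. indicat_real (shell \<Omega> k) \<omega> *\<^sub>R f \<omega>)"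

definition herz_norm ::
  "'a::euclidean_space set \<Rightarrow> ennreal \<Rightarrow> ennreal \<Rightarrow> real \<Rightarrow> ennreal
     \<Rightarrow> ('a \<Rightarrow> 'b::real_normed_vector) \<Rightarrow> ennreal" where
  "herz_norm \<Omega> p r a q f =
     (if q = \<infinity> then
        (SUP k\<in>{-1..}. ennreal (2 powr (of_int k * a)) *
             lorentz_norm (lebesgue_on (shell \<Omega> k)) p r (cutoff \<Omega> k f))
      else epowr
        (\<Sum>\<^sub>\<infinity>k\<in>{-1..}. ennreal (2 powr (of_int k * a * enn2real q)) *
             epowr (lorentz_norm (lebesgue_on (shell \<Omega> k)) p r (cutoff \<Omega> k f)) (enn2real q))
        (1 / enn2real q))"

text \<open>Functions on \<open>\<Omega>\<close> are represented by functions on the whole type; their values outside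
  \<open>\<Omega>\<close> influence neither membership nor the quasi-norm.\<close>

definition herz_space ::
  "'a::euclidean_space set \<Rightarrow> ennreal \<Rightarrow> ennreal \<Rightarrow> real \<Rightarrow> ennreal
     \<Rightarrow> ('a \<Rightarrow> 'b::real_normed_vector) set" where
  "herz_space \<Omega> p r a q =
     {f \<in> borel_measurable (lebesgue_on \<Omega>).
        (\<forall>k\<ge>-1. cutoff \<Omega> k f \<in> lorentz_space (lebesgue_on (shell \<Omega> k)) p r) \<and>
        herz_norm \<Omega> p r a q f < \<infinity>}"

text \<open>A quasi-normed space is given by its carrier together with its quasi-norm.\<close>

type_synonym 'f qn_space = "'f set \<times> ('f \<Rightarrow> ennreal)"

definition HL ::
  "'a::euclidean_space set \<Rightarrow> ennreal \<Rightarrow> ennreal \<Rightarrow> real \<Rightarrow> ennreal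
     \<Rightarrow> ('a \<Rightarrow> 'b::real_normed_vector) qn_space" where
  "HL \<Omega> p r a q = (herz_space \<Omega> p r a q, herz_norm \<Omega> p r a q)"

definition embeds :: "'f qn_space \<Rightarrow> 'f qn_space \<Rightarrow> bool" (infix \<open>\<hookrightarrow>\<close> 50) where
  "E \<hookrightarrow> F \<longleftrightarrow>
     fst E \<subseteq> fst F \<and> (\<exists>C::real. 0 < C \<and> (\<forall>x\<in>fst E. snd F x \<le> ennreal C * snd E x))"

end

theory Submission
  imports Defs
begin

text \<open>Both layers of a Lorentz-Herz norm are \<open>L\<^sup>s\<close> norms: over \<open>(0,\<infinity>)\<close> with the
  measure \<open>dt/t\<close> inside a shell, and over the counting measure on the shells. All the embeddings
  rest on two facts about one shell and two about sequences.

  Inside a shell, monotonicity of \<open>f\<^sup>*\<close> shows that the weak norm \<open>\<parallel>f\<parallel>\<^sub>p\<^sub>,\<^sub>\<infinity>\<close> is dominated by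
  every \<open>\<parallel>f\<parallel>\<^sub>p\<^sub>,\<^sub>r\<close> (\<open>weak_lorentz_norm_le\<close>). Interpolation between \<open>r\<^sub>1\<close> and \<open>\<infinity>\<close> then
  raises the second index (\<open>lorentz_norm_le_second_index\<close>). If moreover the shell has measure at
  most \<open>V\<close>, then \<open>f\<^sup>*\<close> vanishes beyond \<open>V\<close>, and integrating \<open>t\<^sup>p\<^sup>0\<^sup>r\<^sup>-\<^sup>1\<close> over \<open>(0,V)\<close> bounds
  every \<open>p\<^sub>1\<close> norm by a constant times \<open>V\<^sup>p\<^sup>0\<close> times the weak \<open>p\<^sub>2\<close> norm
  (\<open>lorentz_norm_le_weak\<close>).

  Across shells, an estimate of the terms which is uniform in \<open>k\<close> carries over to the sums
  (\<open>HL_embeds_if_shellwise\<close>). This gives (A) at once; it gives (B) because \<open>k \<ge> -1\<close> bounds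
  \<open>2\<^sup>k\<^sup>(\<^sup>a\<^sup>2\<^sup>-\<^sup>a\<^sup>1\<^sup>)\<close>; and it gives (C) and (D) with \<open>V\<close> a constant or a multiple of \<open>2\<^sup>k\<^sup>N\<close>,
  the power \<open>V\<^sup>p\<^sup>0\<close> being absorbed in the constant or in the weight. Finally, (E) is the
  inclusion of sequence spaces (\<open>herz_norm_antimono_outer_index\<close>), which has the same proof as
  the raising of the second index.\<close>

section \<open>Powers of extended nonnegative reals\<close>

lemma epowr_ennreal: "0 \<le> x \<Longrightarrow> epowr (ennreal x) s = ennreal (x powr s)"
  by (simp add: epowr_def)

lemma epowr_infinity [simp]: "epowr \<infinity> s = \<infinity>" "epowr top s = top"
  by (simp_all add: epowr_def)

lemma epowr_zero [simp]: "epowr 0 s = 0"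
  by (simp add: epowr_def)

lemma epowr_one [simp]: "epowr x 1 = x"
  by (cases x) (simp_all add: epowr_ennreal)

lemma epowr_mono:
  assumes "x \<le> y" "0 < s"
  shows "epowr x s \<le> epowr y s"
proof (cases y)
  case (real v)
  with assms obtain u where "x = ennreal u" "0 \<le> u"
    by (cases x) (auto simp: top_unique)
  with real assms show ?thesis
    by (simp add: epowr_ennreal powr_mono2)
qed simp

lemma epowr_mult:
  assumes "0 < s"
  shows "epowr (x * y) s = epowr x s * epowr y s"
proof -
  have pos: "epowr z s \<noteq> 0" if "z \<noteq> 0" for z
    using that by (cases z) (auto simp: epowr_ennreal)
  show ?thesis
  proof (cases "x = 0 \<or> y = 0")
    case False
    with pos have nz: "epowr x s \<noteq> 0" "epowr y s \<noteq> 0" by auto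
    show ?thesis
    proof (cases x)
      case (real u)
      note x = this
      show ?thesis
      proof (cases y)
        case (real v)
        with x show ?thesis
          by (simp add: epowr_ennreal powr_mult flip: ennreal_mult)
      next
        case top
        with nz False show ?thesis
          by (simp add: ennreal_mult_top)
      qed
    next
      case top
      with nz False show ?thesis
        by (simp add: ennreal_top_mult)
    qed
  qed auto
qed

lemma epowr_epowr: "epowr (epowr x s) u = epowr x (s * u)"
  by (cases x) (simp_all add: epowr_ennreal powr_powr)

lemma epowr_add: "epowr x s * epowr x u = epowr x (s + u)"
  by (cases x) (simp_all add: epowr_ennreal powr_add flip: ennreal_mult)

lemma epowr_inverse:
  assumes "0 < s"
  shows "epowr (epowr x s) (1 / s) = x" "epowr (epowr x (1 / s)) s = x"
  using assms by (simp_all add: epowr_epowr)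

lemma epowr_measurable [measurable]: "(\<lambda>x. epowr x s) \<in> borel_measurable borel"
  unfolding epowr_def by measurable

text \<open>For \<open>N = B\<^sup>1\<^sup>/\<^sup>u\<close> the hypothesis says \<open>A \<le> (CN)\<^sup>v\<^sup>-\<^sup>u N\<^sup>u\<close>. It is what one gets from
  \<open>x\<^sup>v \<le> (sup x)\<^sup>v\<^sup>-\<^sup>u x\<^sup>u\<close> by summation or integration once \<open>sup x \<le> C N\<close> is known, and
  is thus the common end of the comparison of \<open>L\<^sup>u\<close> and \<open>L\<^sup>v\<close> norms, whether these are sums or
  integrals.\<close>

lemma exponent_comparison:
  assumes "0 < u" "u \<le> v" "1 \<le> C"
    and A: "A \<le> epowr (ennreal C * epowr B (1 / u)) (v - u) * B"
  shows "epowr A (1 / v) \<le> ennreal C * epowr B (1 / u)"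
proof -
  define S where "S = ennreal C * epowr B (1 / u)"
  have "1 * epowr B (1 / u) \<le> S"
    unfolding S_def using assms(3) by (intro mult_right_mono) auto
  from epowr_mono[OF this, of u] have "B \<le> epowr S u"
    using assms(1) by (simp add: epowr_inverse)
  with A have "A \<le> epowr S (v - u) * epowr S u"
    unfolding S_def by (meson mult_left_mono order_trans zero_le)
  also have "\<dots> = epowr S v"
    by (simp add: epowr_add)
  finally have "epowr A (1 / v) \<le> epowr (epowr S v) (1 / v)"
    using assms by (intro epowr_mono) auto
  then show ?thesis
    using assms by (simp add: epowr_inverse S_def)
qed

lemma epowr_le_interpolate:
  assumes "x \<le> S" "0 < u" "u < v"
  shows "epowr x v \<le> epowr S (v - u) * epowr x u"
proof -
  have "epowr x v = epowr x (v - u) * epowr x u"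
    by (simp add: epowr_add)
  also have "\<dots> \<le> epowr S (v - u) * epowr x u"
    using assms by (intro mult_right_mono epowr_mono) auto
  finally show ?thesis .
qed

section \<open>Embeddings between Lorentz spaces\<close>

lemma decr_rearr_antimono: "t \<le> t' \<Longrightarrow> decr_rearr M f t' \<le> decr_rearr M f t"
  unfolding decr_rearr_def
  by (intro INF_superset_mono) (auto intro: order_trans ennreal_leI)

lemma antimono_borel_measurable_ennreal:
  fixes h :: "real \<Rightarrow> ennreal"
  assumes "antimono h"
  shows "h \<in> borel_measurable borel"
proof (rule borel_measurableI_greater)
  fix y
  have "is_interval {t. y < h t}"
    unfolding is_interval_1 using assms
    by (auto simp: antimono_def intro: less_le_trans)
  then show "{t \<in> space borel. y < h t} \<in> sets borel"
    by (simp add: real_interval_borel_measurable)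
qed

lemma decr_rearr_measurable [measurable]: "decr_rearr M f \<in> borel_measurable borel"
  by (intro antimono_borel_measurable_ennreal antimonoI decr_rearr_antimono)

lemma decr_rearr_eq_0:
  assumes "emeasure M (space M) \<le> ennreal t"
  shows "decr_rearr M f t = 0"
proof -
  have "emeasure M {x \<in> space M. s < norm (f x)} \<le> ennreal t" for s
    using emeasure_space assms by (rule order_trans)
  then have eq: "decr_rearr M f t = (INF s\<in>{0<..}. ennreal s)"
    unfolding decr_rearr_def by (simp add: greaterThan_def)
  show ?thesis
  proof (rule antisym[OF _ zero_le], rule ennreal_le_epsilon)
    fix e :: real
    assume "0 < e"
    then show "decr_rearr M f t \<le> 0 + ennreal e"
      unfolding eq by (auto intro: INF_lower)
  qed
qed

lemma lorentz_norm_infinity: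
  "lorentz_norm M p \<infinity> f = (SUP t\<in>{0<..}. ennreal (t powr enn2real (1 / p)) * decr_rearr M f t)"
  by (simp add: lorentz_norm_def)

lemma lorentz_norm_finite:
  "r \<noteq> \<infinity> \<Longrightarrow> lorentz_norm M p r f = epowr
        (\<integral>\<^sup>+t\<in>{0<..}. (epowr (ennreal (t powr enn2real (1 / p)) * decr_rearr M f t) (enn2real r)
             * ennreal (1 / t)) \<partial>lborel)
        (1 / enn2real r)"
  by (simp add: lorentz_norm_def)

text \<open>Since \<open>f\<^sup>*\<close> decreases, the integrand defining the \<open>(p,r)\<close> norm is at least
  \<open>((t/2)\<^sup>1\<^sup>/\<^sup>p f\<^sup>*(t))\<^sup>r / t\<close> on \<open>[t/2, t]\<close>; integrating this constant over that interval of length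
  \<open>t/2\<close> bounds the weak norm.\<close>

lemma weak_lorentz_norm_le:
  assumes "0 < r"
  shows "lorentz_norm M p \<infinity> f
    \<le> ennreal (2 powr (enn2real (1 / p) + enn2real (1 / r))) * lorentz_norm M p r f"
proof (cases "r = \<infinity>")
  case True
  have "1 * lorentz_norm M p r f
    \<le> ennreal (2 powr (enn2real (1 / p) + enn2real (1 / r))) * lorentz_norm M p r f"
    by (intro mult_right_mono) (auto intro: ge_one_powr_ge_zero)
  then show ?thesis using True by simp
next
  case False
  define \<theta> where "\<theta> = enn2real (1 / p)"
  define \<rho> where "\<rho> = enn2real r"
  have r: "r = ennreal \<rho>" "0 < \<rho>"
    using False assms by (auto simp: \<rho>_def enn2real_positive_iff top.not_eq_extremum)
  have \<theta>: "0 \<le> \<theta>" by (simp add: \<theta>_def)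
  have r': "enn2real (1 / r) = 1 / \<rho>"
    using r by (simp add: divide_ennreal flip: ennreal_1)
  let ?h = "decr_rearr M f"
  define J where "J = (\<integral>\<^sup>+t\<in>{0<..}. (epowr (ennreal (t powr \<theta>) * ?h t) \<rho>
             * ennreal (1 / t)) \<partial>lborel)"
  have "ennreal (t powr \<theta>) * ?h t \<le> ennreal (2 powr (\<theta> + 1 / \<rho>)) * epowr J (1 / \<rho>)"
    if t: "0 < t" for t
  proof -
    define c where "c = epowr (ennreal ((t / 2) powr \<theta>) * ?h t) \<rho>"
    have "c * ennreal (1 / 2) = c * (ennreal (1 / t) * ennreal (t / 2))"
      using t by (simp flip: ennreal_mult)
    also have "\<dots> = (\<integral>\<^sup>+s. c * ennreal (1 / t) * indicator {t / 2..t} s \<partial>lborel)"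
      using t by (subst nn_integral_cmult_indicator) (simp_all add: mult.assoc)
    also have "\<dots> \<le> J"
      unfolding J_def
    proof (intro nn_integral_mono)
      fix s
      show "c * ennreal (1 / t) * indicator {t / 2..t} s
        \<le> epowr (ennreal (s powr \<theta>) * ?h s) \<rho> * ennreal (1 / s) * indicator {0<..} s"
      proof (cases "s \<in> {t / 2..t}")
        case True
        with t have "0 < s" "s \<le> t" "t / 2 \<le> s" by auto
        moreover have "c \<le> epowr (ennreal (s powr \<theta>) * ?h s) \<rho>"
          unfolding c_def using calculation t r \<theta>
          by (intro epowr_mono mult_mono ennreal_leI powr_mono2 decr_rearr_antimono) auto
        moreover have "ennreal (1 / t) \<le> ennreal (1 / s)"
          using calculation by (intro ennreal_leI) (simp add: frac_le)
        ultimately show ?thesis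
          by (auto intro!: mult_mono)
      qed simp
    qed
    finally have "epowr (c * ennreal (1 / 2)) (1 / \<rho>) \<le> epowr J (1 / \<rho>)"
      using r by (intro epowr_mono) auto
    then have *: "ennreal ((t / 2) powr \<theta>) * ?h t * ennreal ((1 / 2) powr (1 / \<rho>)) \<le> epowr J (1 / \<rho>)"
      using r by (simp add: epowr_mult c_def epowr_inverse epowr_ennreal powr_powr del: ennreal_half)
    have "t powr \<theta> = 2 powr (\<theta> + 1 / \<rho>) * ((t / 2) powr \<theta> * (1 / 2) powr (1 / \<rho>))"
      using t by (simp add: powr_divide powr_add)
    then have "ennreal (t powr \<theta>) * ?h t = ennreal (2 powr (\<theta> + 1 / \<rho>)) *
        (ennreal ((t / 2) powr \<theta>) * ?h t * ennreal ((1 / 2) powr (1 / \<rho>)))"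
      by (simp add: ennreal_mult mult_ac)
    also have "\<dots> \<le> ennreal (2 powr (\<theta> + 1 / \<rho>)) * epowr J (1 / \<rho>)"
      using * by (intro mult_left_mono) auto
    finally show ?thesis .
  qed
  then show ?thesis
    unfolding lorentz_norm_infinity lorentz_norm_finite[OF False] r'
    by (auto intro!: SUP_least simp: J_def \<theta>_def \<rho>_def)
qed

text \<open>The second Lorentz index: interpolate the larger exponent between the smaller one and the
  supremum, which the weak norm controls.\<close>

lemma lorentz_norm_le_second_index:
  assumes "0 < r1" "r1 \<le> r2"
  shows "lorentz_norm M p r2 f
    \<le> ennreal (2 powr (enn2real (1 / p) + enn2real (1 / r1))) * lorentz_norm M p r1 f"
proof -
  define C where "C = 2 powr (enn2real (1 / p) + enn2real (1 / r1))"
  have C: "1 \<le> C" by (auto simp: C_def intro: ge_one_powr_ge_zero)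
  have weak: "lorentz_norm M p \<infinity> f \<le> ennreal C * lorentz_norm M p r1 f"
    unfolding C_def by (rule weak_lorentz_norm_le[OF assms(1)])
  consider "r2 = \<infinity>" | "r1 = r2" | "r2 < \<infinity>" "r1 < r2"
    using assms by (auto simp: less_top[symmetric] order_le_less)
  then have "lorentz_norm M p r2 f \<le> ennreal C * lorentz_norm M p r1 f"
  proof cases
    case 1
    with weak show ?thesis by simp
  next
    case 2
    have "1 * lorentz_norm M p r1 f \<le> ennreal C * lorentz_norm M p r1 f"
      using C by (intro mult_right_mono) auto
    with 2 show ?thesis by simp
  next
    case 3
    define u v where "u = enn2real r1" and "v = enn2real r2"
    have r1: "r1 = ennreal u" "r1 \<noteq> \<infinity>" and r2: "r2 = ennreal v" "r2 \<noteq> \<infinity>"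
      using 3 by (auto simp: u_def v_def)
    have uv: "0 < u" "u < v"
      using assms(1) 3(2) unfolding r1(1) r2(1) by (auto simp: ennreal_less_iff)
    define g where "g t = ennreal (t powr enn2real (1 / p)) * decr_rearr M f t" for t
    have [measurable]: "g \<in> borel_measurable borel" unfolding g_def by measurable
    define A where "A = (\<integral>\<^sup>+t\<in>{0<..}. (epowr (g t) v * ennreal (1 / t)) \<partial>lborel)"
    define B where "B = (\<integral>\<^sup>+t\<in>{0<..}. (epowr (g t) u * ennreal (1 / t)) \<partial>lborel)"
    have LB: "lorentz_norm M p r1 f = epowr B (1 / u)"
      and LA: "lorentz_norm M p r2 f = epowr A (1 / v)"
      by (simp_all only: lorentz_norm_finite[OF r1(2)] lorentz_norm_finite[OF r2(2)]
          A_def B_def g_def u_def v_def)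
    define S where "S = ennreal C * epowr B (1 / u)"
    have gS: "g t \<le> S" if "0 < t" for t
    proof -
      have "g t \<le> lorentz_norm M p \<infinity> f"
        unfolding lorentz_norm_infinity g_def using that by (intro SUP_upper) auto
      with weak show ?thesis unfolding S_def LB by (rule order_trans[rotated])
    qed
    have "A \<le> (\<integral>\<^sup>+t. epowr S (v - u) * (epowr (g t) u * ennreal (1 / t) * indicator {0<..} t) \<partial>lborel)"
      unfolding A_def
    proof (intro nn_integral_mono)
      fix t
      show "epowr (g t) v * ennreal (1 / t) * indicator {0<..} t
        \<le> epowr S (v - u) * (epowr (g t) u * ennreal (1 / t) * indicator {0<..} t)"
        using mult_right_mono[OF epowr_le_interpolate[OF gS uv], of t "ennreal (1 / t)"]
        by (auto simp: mult.assoc split: split_indicator)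
    qed
    also have "\<dots> = epowr S (v - u) * B"
      unfolding B_def by (rule nn_integral_cmult) measurable
    finally show ?thesis
      unfolding LA LB S_def using uv C by (intro exponent_comparison) auto
  qed
  then show ?thesis by (simp add: C_def)
qed

lemma nn_integral_powr_from_0:
  assumes "0 < \<alpha>" "0 \<le> V"
  shows "(\<integral>\<^sup>+t\<in>{0..V}. ennreal (t powr (\<alpha> - 1)) \<partial>lborel) = ennreal (V powr \<alpha> / \<alpha>)"
  using nn_integral_has_integral_lebesgue'[OF _ has_integral_powr_from_0[of "\<alpha> - 1" V]] assms
  by simp

text \<open>On a space of measure at most \<open>V\<close> the rearrangement vanishes from \<open>V\<close> on, and below \<open>V\<close> the
  weak \<open>p\<^sub>2\<close> norm \<open>W\<close> gives \<open>t\<^sup>1\<^sup>/\<^sup>p\<^sup>1 f\<^sup>*(t) \<le> t\<^sup>p\<^sup>0 W\<close> with a positive exponent, which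
  makes \<open>\<integral>\<^sub>0\<^sup>V t\<^sup>p\<^sup>0\<^sup>r dt/t\<close> finite for every \<open>r\<close>, however small.\<close>

lemma lorentz_norm_le_weak:
  fixes p1 p2 :: real
  defines "p0 \<equiv> 1 / p1 - 1 / p2"
  assumes p: "0 < p1" "p1 < p2" and r: "0 < r" and V: "0 \<le> V"
    and M: "emeasure M (space M) \<le> ennreal V"
  shows "lorentz_norm M (ennreal p1) r f
    \<le> ennreal ((if r = \<infinity> then 1 else (1 / (p0 * enn2real r)) powr (1 / enn2real r)) * V powr p0)
       * lorentz_norm M (ennreal p2) \<infinity> f"
proof -
  let ?h = "decr_rearr M f"
  define W where "W = lorentz_norm M (ennreal p2) \<infinity> f"
  have p0: "0 < p0" using p by (simp add: p0_def frac_less2)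
  have e: "enn2real (1 / ennreal p1) = 1 / p1" "enn2real (1 / ennreal p2) = 1 / p2"
    using p by (simp_all add: divide_ennreal flip: ennreal_1)
  have below: "ennreal (t powr (1 / p1)) * ?h t \<le> ennreal (t powr p0) * W" if t: "0 < t" for t
  proof -
    have "t powr (1 / p1) = t powr p0 * t powr (1 / p2)"
      using t by (simp add: p0_def flip: powr_add)
    then have "ennreal (t powr (1 / p1)) * ?h t
        = ennreal (t powr p0) * (ennreal (t powr (1 / p2)) * ?h t)"
      by (simp add: ennreal_mult mult.assoc)
    also have "\<dots> \<le> ennreal (t powr p0) * W"
      unfolding W_def lorentz_norm_infinity e using t
      by (intro mult_left_mono SUP_upper) auto
    finally show ?thesis .
  qed
  have above: "?h t = 0" if "V \<le> t" for t
    using M ennreal_leI[OF that] by (intro decr_rearr_eq_0) (rule order_trans)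
  show ?thesis
  proof (cases "r = \<infinity>")
    case True
    have "ennreal (t powr (1 / p1)) * ?h t \<le> ennreal (V powr p0) * W" if t: "0 < t" for t
    proof (cases "V \<le> t")
      case True
      then show ?thesis by (simp add: above)
    next
      case False
      then have "ennreal (t powr p0) * W \<le> ennreal (V powr p0) * W"
        using t p0 by (intro mult_right_mono ennreal_leI powr_mono2) auto
      with below[OF t] show ?thesis by (rule order_trans)
    qed
    then show ?thesis
      unfolding True lorentz_norm_infinity[of M "ennreal p1"] e W_def by (auto intro!: SUP_least)
  next
    case False
    define \<rho> where "\<rho> = enn2real r"
    have \<rho>: "0 < \<rho>"
      using False r by (auto simp: \<rho>_def enn2real_positive_iff top.not_eq_extremum)
    define J where "J = (\<integral>\<^sup>+t\<in>{0<..}. (epowr (ennreal (t powr (1 / p1)) * ?h t) \<rho>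
             * ennreal (1 / t)) \<partial>lborel)"
    have "J \<le> (\<integral>\<^sup>+t. epowr W \<rho> * (ennreal (t powr (p0 * \<rho> - 1)) * indicator {0..V} t) \<partial>lborel)"
      unfolding J_def
    proof (intro nn_integral_mono)
      fix t :: real
      show "epowr (ennreal (t powr (1 / p1)) * ?h t) \<rho> * ennreal (1 / t) * indicator {0<..} t
        \<le> epowr W \<rho> * (ennreal (t powr (p0 * \<rho> - 1)) * indicator {0..V} t)"
      proof (cases "0 < t \<and> t < V")
        case True
        then have "epowr (ennreal (t powr (1 / p1)) * ?h t) \<rho> * ennreal (1 / t)
          \<le> epowr (ennreal (t powr p0) * W) \<rho> * ennreal (1 / t)"
          using \<rho> by (intro mult_right_mono epowr_mono below) auto
        also have "\<dots> = epowr W \<rho> * (ennreal (t powr (p0 * \<rho>)) * ennreal (1 / t))"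
          using \<rho> by (simp add: epowr_mult epowr_ennreal powr_powr mult_ac)
        also have "ennreal (t powr (p0 * \<rho>)) * ennreal (1 / t) = ennreal (t powr (p0 * \<rho> - 1))"
          using True by (simp add: powr_diff flip: ennreal_mult)
        finally show ?thesis using True by simp
      next
        case False
        then show ?thesis by (auto simp: above split: split_indicator)
      qed
    qed
    also have "\<dots> = epowr W \<rho> * ennreal (V powr (p0 * \<rho>) / (p0 * \<rho>))"
      using p0 \<rho> V by (subst nn_integral_cmult) (auto simp: nn_integral_powr_from_0)
    finally have "epowr J (1 / \<rho>) \<le> epowr (epowr W \<rho> * ennreal (V powr (p0 * \<rho>) / (p0 * \<rho>))) (1 / \<rho>)"
      using \<rho> by (intro epowr_mono) auto
    also have "\<dots> = W * ennreal ((V powr (p0 * \<rho>) / (p0 * \<rho>)) powr (1 / \<rho>))"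
      using \<rho> p0 by (simp add: epowr_mult epowr_inverse epowr_ennreal)
    also have "(V powr (p0 * \<rho>) / (p0 * \<rho>)) powr (1 / \<rho>) = (1 / (p0 * \<rho>)) powr (1 / \<rho>) * V powr p0"
      using \<rho> p0 V by (simp add: powr_divide powr_powr)
    finally show ?thesis
      using False unfolding lorentz_norm_finite[OF False] e
      by (simp add: J_def W_def \<rho>_def mult_ac)
  qed
qed

lemma lorentz_norm_le_first_index:
  fixes p1 p2 :: real and r1 r2 :: ennreal
  defines "p0 \<equiv> 1 / p1 - 1 / p2"
  assumes p: "0 < p1" "p1 < p2" and r: "0 < r1" "0 < r2"
  obtains K where "0 < K"
    "\<And>M (f :: 'a \<Rightarrow> 'b::real_normed_vector) V. 0 \<le> V \<Longrightarrow> emeasure M (space M) \<le> ennreal V \<Longrightarrow>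
       lorentz_norm M (ennreal p1) r1 f
         \<le> ennreal (K * V powr p0) * lorentz_norm M (ennreal p2) r2 f"
proof
  let ?K1 = "if r1 = \<infinity> then 1 else (1 / (p0 * enn2real r1)) powr (1 / enn2real r1)"
  let ?K2 = "2 powr (enn2real (1 / ennreal p2) + enn2real (1 / r2))"
  have p0: "0 < p0" using p by (simp add: p0_def frac_less2)
  have K1: "0 < ?K1"
    using p0 r by (auto simp: enn2real_eq_0_iff)
  then show "0 < ?K1 * ?K2" by (intro mult_pos_pos) auto
  fix M :: "'a measure" and f :: "'a \<Rightarrow> 'b" and V :: real
  assume V: "0 \<le> V" "emeasure M (space M) \<le> ennreal V"
  have "lorentz_norm M (ennreal p1) r1 f
      \<le> ennreal (?K1 * V powr p0) * lorentz_norm M (ennreal p2) \<infinity> f"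
    unfolding p0_def by (intro lorentz_norm_le_weak p r V)
  also have "\<dots> \<le> ennreal (?K1 * V powr p0) * (ennreal ?K2 * lorentz_norm M (ennreal p2) r2 f)"
    by (intro mult_left_mono weak_lorentz_norm_le r) auto
  also have "\<dots> = ennreal (?K1 * V powr p0 * ?K2) * lorentz_norm M (ennreal p2) r2 f"
    using K1 by (subst ennreal_mult) (auto simp: mult.assoc)
  also have "?K1 * V powr p0 * ?K2 = ?K1 * ?K2 * V powr p0" by (simp add: mult_ac)
  finally show "lorentz_norm M (ennreal p1) r1 f
      \<le> ennreal (?K1 * ?K2 * V powr p0) * lorentz_norm M (ennreal p2) r2 f" .
qed

section \<open>The dyadic shells\<close>

lemma shell_lebesgue:
  fixes \<Omega> :: "'a::euclidean_space set"
  assumes "\<Omega> \<in> sets lebesgue"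
  shows "shell \<Omega> k \<in> sets lebesgue"
proof -
  let ?B = "if k = -1 then {x :: 'a. norm x < 1 / 2}
    else {x. 2 powr (of_int k - 1) \<le> norm x \<and> norm x < 2 powr (of_int k)}"
  have "?B \<in> sets borel"
    by (cases "k = -1"; simp only: if_True if_False simp_thms; measurable)
  then have "?B \<in> sets lebesgue"
    by (rule sets_completionI_sets[of _ lborel, simplified sets_lborel])
  with assms have "\<Omega> \<inter> ?B \<in> sets lebesgue"
    by (rule sets.Int)
  moreover have "shell \<Omega> k = \<Omega> \<inter> ?B"
    by (auto simp: shell_def)
  ultimately show ?thesis by (simp only:)
qed

lemma emeasure_lebesgue_on_space:
  "S \<in> sets lebesgue \<Longrightarrow> emeasure (lebesgue_on S) (space (lebesgue_on S)) = emeasure lebesgue S"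
  by (simp add: emeasure_restrict_space)

lemma emeasure_shell_le:
  fixes \<Omega> :: "'a::euclidean_space set"
  assumes "-1 \<le> k"
  shows "emeasure lebesgue (shell \<Omega> k)
    \<le> ennreal (unit_ball_vol (real DIM('a)) * 2 powr (of_int k * real DIM('a)))"
proof -
  have "shell \<Omega> k \<subseteq> ball 0 (2 powr of_int k)"
    by (auto simp: shell_def powr_minus_divide split: if_splits)
  then have "emeasure lebesgue (shell \<Omega> k) \<le> emeasure lebesgue (ball (0::'a) (2 powr of_int k))"
    by (intro emeasure_mono) auto
  also have "\<dots> = ennreal (unit_ball_vol (real DIM('a)) * (2 powr of_int k) ^ DIM('a))"
    by (simp add: emeasure_ball)
  also have "(2 powr of_int k) ^ DIM('a) = (2::real) powr (of_int k * real DIM('a))"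
    by (simp add: powr_powr flip: powr_realpow)
  finally show ?thesis .
qed

section \<open>Herz spaces\<close>

definition herz_term ::
  "'a::euclidean_space set \<Rightarrow> ennreal \<Rightarrow> ennreal \<Rightarrow> real
     \<Rightarrow> ('a \<Rightarrow> 'b::real_normed_vector) \<Rightarrow> int \<Rightarrow> ennreal" where
  "herz_term \<Omega> p r a f k = ennreal (2 powr (of_int k * a)) *
     lorentz_norm (lebesgue_on (shell \<Omega> k)) p r (cutoff \<Omega> k f)"

lemma herz_norm_infinity: "herz_norm \<Omega> p r a \<infinity> f = (SUP k\<in>{-1..}. herz_term \<Omega> p r a f k)"
  by (simp add: herz_norm_def herz_term_def)

lemma herz_norm_finite:
  assumes "0 < q" "q \<noteq> \<infinity>"
  shows "herz_norm \<Omega> p r a q f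
    = epowr (\<Sum>\<^sub>\<infinity>k\<in>{-1..}. epowr (herz_term \<Omega> p r a f k) (enn2real q)) (1 / enn2real q)"
proof -
  have "0 < enn2real q"
    using assms by (auto simp: enn2real_positive_iff top.not_eq_extremum)
  then show ?thesis
    using assms(2)
    by (simp add: herz_norm_def herz_term_def epowr_mult epowr_ennreal powr_powr)
qed

lemma sum_le_infsum_ennreal:
  fixes f :: "'a \<Rightarrow> ennreal"
  assumes "finite F" "F \<subseteq> A"
  shows "sum f F \<le> infsum f A"
  by (subst nonneg_infsum_complete) (use assms in \<open>auto intro: SUP_upper\<close>)

lemma infsum_ennreal_le_cmult:
  fixes f g :: "'a \<Rightarrow> ennreal"
  assumes "\<And>x. x \<in> A \<Longrightarrow> f x \<le> c * g x"
  shows "infsum f A \<le> c * infsum g A"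
proof -
  have "sum f F \<le> c * infsum g A" if "finite F" "F \<subseteq> A" for F
  proof -
    have "sum f F \<le> (\<Sum>x\<in>F. c * g x)" using assms that by (intro sum_mono) auto
    also have "\<dots> = c * sum g F" by (simp add: sum_distrib_left)
    also have "\<dots> \<le> c * infsum g A"
      using that by (intro mult_left_mono sum_le_infsum_ennreal) auto
    finally show ?thesis .
  qed
  then show ?thesis
    by (subst nonneg_infsum_complete) (auto intro!: SUP_least)
qed

lemma herz_norm_mono:
  assumes "0 < q"
    and le: "\<And>k. -1 \<le> k \<Longrightarrow> herz_term \<Omega> p' r' a' f k \<le> c * herz_term \<Omega> p r a f k"
  shows "herz_norm \<Omega> p' r' a' q f \<le> c * herz_norm \<Omega> p r a q f"
proof (cases "q = \<infinity>")
  case True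
  show ?thesis
    unfolding True herz_norm_infinity
  proof (rule SUP_least)
    fix k :: int
    assume "k \<in> {-1..}"
    then have "herz_term \<Omega> p' r' a' f k \<le> c * herz_term \<Omega> p r a f k"
      and "herz_term \<Omega> p r a f k \<le> (SUP k\<in>{-1..}. herz_term \<Omega> p r a f k)"
      by (auto intro: le SUP_upper)
    then show "herz_term \<Omega> p' r' a' f k \<le> c * (SUP k\<in>{-1..}. herz_term \<Omega> p r a f k)"
      by (meson mult_left_mono order_trans zero_le)
  qed
next
  case False
  define s where "s = enn2real q"
  have s: "0 < s"
    using False assms by (auto simp: s_def enn2real_positive_iff top.not_eq_extremum)
  have "(\<Sum>\<^sub>\<infinity>k\<in>{-1..}. epowr (herz_term \<Omega> p' r' a' f k) s)
    \<le> epowr c s * (\<Sum>\<^sub>\<infinity>k\<in>{-1..}. epowr (herz_term \<Omega> p r a f k) s)"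
    using s le by (intro infsum_ennreal_le_cmult) (auto simp: epowr_mono simp flip: epowr_mult)
  from epowr_mono[OF this, of "1 / s"] show ?thesis
    using s assms(1) False by (simp add: herz_norm_finite epowr_mult epowr_inverse flip: s_def)
qed

text \<open>The outer sum is the same on both sides, so an embedding follows from an estimate on each
  shell whose constant does not depend on the shell.\<close>

lemma HL_embeds_if_shellwise:
  fixes \<Omega> :: "'a::euclidean_space set"
  assumes "0 < q" "0 < C"
    and le: "\<And>k (f :: 'a \<Rightarrow> 'b::real_normed_vector). -1 \<le> k \<Longrightarrow>
       herz_term \<Omega> p' r' a' f k \<le> ennreal C * herz_term \<Omega> p r a f k"
  shows "(HL \<Omega> p r a q :: ('a \<Rightarrow> 'b) qn_space) \<hookrightarrow> HL \<Omega> p' r' a' q"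
proof -
  have norm: "herz_norm \<Omega> p' r' a' q f \<le> ennreal C * herz_norm \<Omega> p r a q f" for f :: "'a \<Rightarrow> 'b"
    by (intro herz_norm_mono le assms)
  have finite_iff: "herz_term \<Omega> p r a f k < \<infinity>
      \<longleftrightarrow> lorentz_norm (lebesgue_on (shell \<Omega> k)) p r (cutoff \<Omega> k f) < \<infinity>"
    for p r a k and f :: "'a \<Rightarrow> 'b"
    by (auto simp: herz_term_def ennreal_mult_less_top)
  have "f \<in> herz_space \<Omega> p' r' a' q" if f: "f \<in> herz_space \<Omega> p r a q" for f :: "'a \<Rightarrow> 'b"
  proof -
    have "lorentz_norm (lebesgue_on (shell \<Omega> k)) p' r' (cutoff \<Omega> k f) < \<infinity>" if k: "-1 \<le> k" for k
    proof -
      have "herz_term \<Omega> p r a f k < \<infinity>"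
        using f k by (simp only: finite_iff herz_space_def lorentz_space_def mem_Collect_eq)
      then have "ennreal C * herz_term \<Omega> p r a f k < \<infinity>"
        by (simp add: ennreal_mult_less_top)
      with le[OF k] have "herz_term \<Omega> p' r' a' f k < \<infinity>"
        by (rule le_less_trans)
      then show ?thesis by (simp only: finite_iff)
    qed
    moreover have "herz_norm \<Omega> p' r' a' q f < \<infinity>"
      using f by (intro le_less_trans[OF norm]) (simp add: herz_space_def ennreal_mult_less_top)
    ultimately show ?thesis
      using f by (auto simp: herz_space_def lorentz_space_def)
  qed
  with norm assms(2) show ?thesis
    by (auto simp: embeds_def HL_def)
qed

text \<open>This is the inclusion of \<open>\<ell>\<^sup>u\<close> in \<open>\<ell>\<^sup>v\<close> for \<open>u \<le> v\<close>: each term of a sequence is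
  bounded by its \<open>\<ell>\<^sup>u\<close> norm, so that the constant is \<open>1\<close>.\<close>

lemma herz_norm_antimono_outer_index:
  assumes "0 < q2" "q2 \<le> q1"
  shows "herz_norm \<Omega> p r a q1 f \<le> herz_norm \<Omega> p r a q2 f"
proof -
  consider "q1 = q2" | "q2 < q1" using assms by (auto simp: order_le_less)
  then show ?thesis
  proof cases
    case 2
    define u where "u = enn2real q2"
    have "q2 < top"
      using 2 top_greatest by (rule less_le_trans)
    then have q2: "q2 \<noteq> \<infinity>" "q2 = ennreal u" and u: "0 < u"
      using assms(1) by (auto simp: u_def enn2real_positive_iff)
    let ?x = "herz_term \<Omega> p r a f"
    define B where "B = (\<Sum>\<^sub>\<infinity>k\<in>{-1..}. epowr (?x k) u)"
    have N: "herz_norm \<Omega> p r a q2 f = epowr B (1 / u)"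
      unfolding B_def u_def by (rule herz_norm_finite[OF assms(1) q2(1)])
    have sup: "?x k \<le> epowr B (1 / u)" if "-1 \<le> k" for k
    proof -
      have "epowr (?x k) u \<le> B"
        using sum_le_infsum_ennreal[of "{k}" "{-1..}" "\<lambda>k. epowr (?x k) u"] that
        by (simp add: B_def)
      from epowr_mono[OF this, of "1 / u"] show ?thesis
        using u by (simp add: epowr_inverse)
    qed
    show ?thesis
    proof (cases "q1 = \<infinity>")
      case True
      show ?thesis
        unfolding True herz_norm_infinity N using sup by (auto intro: SUP_least)
    next
      case False
      define v where "v = enn2real q1"
      have q1: "q1 = ennreal v" "0 < q1"
        using False 2 assms(1) by (auto simp: v_def top.not_eq_extremum)
      have uv: "u < v"
        using 2 u by (auto simp: q1 q2 ennreal_less_iff)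
      have "(\<Sum>\<^sub>\<infinity>k\<in>{-1..}. epowr (?x k) v) \<le> epowr (epowr B (1 / u)) (v - u) * B"
        unfolding B_def
        using sup u uv
        by (intro infsum_ennreal_le_cmult epowr_le_interpolate) (auto simp: B_def)
      then have "epowr (\<Sum>\<^sub>\<infinity>k\<in>{-1..}. epowr (?x k) v) (1 / v) \<le> ennreal 1 * epowr B (1 / u)"
        using u uv by (intro exponent_comparison) auto
      then show ?thesis
        unfolding N v_def by (simp only: herz_norm_finite[OF q1(2) False] ennreal_1 mult_1)
    qed
  qed simp
qed

lemma HL_embeds_second_index:
  fixes \<Omega> :: "'a::euclidean_space set"
  assumes "0 < r1" "r1 \<le> r2" "0 < q"
  shows "(HL \<Omega> p r1 a q :: ('a \<Rightarrow> 'b::real_normed_vector) qn_space) \<hookrightarrow> HL \<Omega> p r2 a q"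
proof (rule HL_embeds_if_shellwise)
  let ?C = "2 powr (enn2real (1 / p) + enn2real (1 / r1))"
  fix k :: int and f :: "'a \<Rightarrow> 'b"
  show "herz_term \<Omega> p r2 a f k \<le> ennreal ?C * herz_term \<Omega> p r1 a f k"
    unfolding herz_term_def
    by (subst mult.left_commute) (intro mult_left_mono lorentz_norm_le_second_index assms zero_le)
qed (use assms in auto)

lemma HL_embeds_weight:
  fixes \<Omega> :: "'a::euclidean_space set"
  assumes "a2 \<le> a1" "0 < q"
  shows "(HL \<Omega> p r a1 q :: ('a \<Rightarrow> 'b::real_normed_vector) qn_space) \<hookrightarrow> HL \<Omega> p r a2 q"
proof (rule HL_embeds_if_shellwise)
  fix k :: int and f :: "'a \<Rightarrow> 'b"
  assume k: "-1 \<le> k"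
  have "- 1 * (a1 - a2) \<le> of_int k * (a1 - a2)"
    using k assms(1) by (intro mult_right_mono) auto
  then have "2 powr (of_int k * a2) \<le> (2::real) powr (a1 - a2 + of_int k * a1)"
    by (intro powr_mono) (auto simp: algebra_simps)
  then have "ennreal (2 powr (of_int k * a2)) \<le> ennreal (2 powr (a1 - a2)) * ennreal (2 powr (of_int k * a1))"
    by (simp add: powr_add flip: ennreal_mult)
  then show "herz_term \<Omega> p r a2 f k \<le> ennreal (2 powr (a1 - a2)) * herz_term \<Omega> p r a1 f k"
    unfolding herz_term_def mult.assoc[symmetric] by (intro mult_right_mono) auto
qed (use assms in auto)

text \<open>Lowering \<open>p\<^sub>2\<close> to \<open>p\<^sub>1\<close> on shell \<open>k\<close> costs \<open>\<mu>(\<Omega>\<^sub>k)\<^sup>p\<^sup>0\<close>. A bound of the form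
  \<open>\<mu>(\<Omega>\<^sub>k) \<le> c 2\<^sup>k\<^sup>d\<close> turns this into an increase of the weight by \<open>d p\<^sub>0\<close>; \<open>d = 0\<close> covers
  sets of finite measure, and \<open>d = N\<close> holds for all sets.\<close>

lemma HL_embeds_first_index:
  fixes \<Omega> :: "'a::euclidean_space set" and p1 p2 :: real
  defines "p0 \<equiv> 1 / p1 - 1 / p2"
  assumes \<Omega>: "\<Omega> \<in> sets lebesgue"
    and p: "0 < p1" "p1 < p2" and r: "0 < r1" "0 < r2" and q: "0 < q" and c: "0 < c"
    and bound: "\<And>k. -1 \<le> k \<Longrightarrow>
      emeasure lebesgue (shell \<Omega> k) \<le> ennreal (c * 2 powr (of_int k * d))"
  shows "(HL \<Omega> (ennreal p2) r2 (a + d * p0) q :: ('a \<Rightarrow> 'b::real_normed_vector) qn_space)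
    \<hookrightarrow> HL \<Omega> (ennreal p1) r1 a q"
proof -
  obtain K where K: "0 < K" and
    lorentz: "\<And>M (f :: 'a \<Rightarrow> 'b) V. 0 \<le> V \<Longrightarrow> emeasure M (space M) \<le> ennreal V \<Longrightarrow>
       lorentz_norm M (ennreal p1) r1 f
         \<le> ennreal (K * V powr p0) * lorentz_norm M (ennreal p2) r2 f"
    using lorentz_norm_le_first_index[OF p r] unfolding p0_def by blast
  show ?thesis
  proof (rule HL_embeds_if_shellwise)
    show "0 < K * c powr p0" using K c by simp
    fix k :: int and f :: "'a \<Rightarrow> 'b"
    assume k: "-1 \<le> k"
    let ?M = "lebesgue_on (shell \<Omega> k)" and ?V = "c * 2 powr (of_int k * d)"
    have M: "emeasure ?M (space ?M) \<le> ennreal ?V"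
      unfolding emeasure_lebesgue_on_space[OF shell_lebesgue[OF \<Omega>]] by (rule bound[OF k])
    have factor: "2 powr (of_int k * a) * (K * ?V powr p0)
        = K * c powr p0 * 2 powr (of_int k * (a + d * p0))"
      using c by (simp add: powr_mult powr_powr powr_add algebra_simps)
    have "herz_term \<Omega> (ennreal p1) r1 a f k \<le> ennreal (2 powr (of_int k * a)) *
        (ennreal (K * ?V powr p0) * lorentz_norm ?M (ennreal p2) r2 (cutoff \<Omega> k f))"
      unfolding herz_term_def using c by (intro mult_left_mono lorentz M) auto
    also have "\<dots> = ennreal (2 powr (of_int k * a) * (K * ?V powr p0)) *
        lorentz_norm ?M (ennreal p2) r2 (cutoff \<Omega> k f)"
      using K by (simp add: ennreal_mult mult.assoc)
    also have "\<dots> = ennreal (K * c powr p0) * herz_term \<Omega> (ennreal p2) r2 (a + d * p0) f k"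
      unfolding factor herz_term_def using K by (simp add: ennreal_mult mult.assoc)
    finally show "herz_term \<Omega> (ennreal p1) r1 a f k
        \<le> ennreal (K * c powr p0) * herz_term \<Omega> (ennreal p2) r2 (a + d * p0) f k" .
  qed (rule q)
qed

lemma HL_embeds_first_index_finite_measure:
  fixes \<Omega> :: "'a::euclidean_space set" and p1 p2 :: real
  assumes \<Omega>: "\<Omega> \<in> sets lebesgue" "emeasure lebesgue \<Omega> < \<infinity>"
    and p: "0 < p1" "p1 < p2" and r: "0 < r1" "0 < r2" and q: "0 < q"
  shows "(HL \<Omega> (ennreal p2) r2 a q :: ('a \<Rightarrow> 'b::real_normed_vector) qn_space)
    \<hookrightarrow> HL \<Omega> (ennreal p1) r1 a q"
proof -
  (* The summand 1 keeps the constant positive for null sets. *)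
  let ?c = "measure lebesgue \<Omega> + 1"
  have "emeasure lebesgue (shell \<Omega> k) \<le> ennreal (?c * 2 powr (of_int k * 0))" for k
  proof -
    have "emeasure lebesgue (shell \<Omega> k) \<le> emeasure lebesgue \<Omega>"
      using \<Omega> by (intro emeasure_mono) (auto simp: shell_def)
    also have "\<dots> = ennreal (measure lebesgue \<Omega>)"
      using \<Omega>(2) by (simp add: emeasure_eq_ennreal_measure)
    also have "\<dots> \<le> ennreal (?c * 2 powr (of_int k * 0))"
      by (intro ennreal_leI) simp
    finally show ?thesis .
  qed
  moreover have "0 < ?c" by (simp add: add_nonneg_pos)
  ultimately show ?thesis
    using HL_embeds_first_index[OF \<Omega>(1) p r q, of ?c 0 a] by simp
qed

lemma HL_embeds_outer_index:
  fixes \<Omega> :: "'a::euclidean_space set"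
  assumes "0 < q2" "q2 \<le> q1"
  shows "(HL \<Omega> p r a q2 :: ('a \<Rightarrow> 'b::real_normed_vector) qn_space) \<hookrightarrow> HL \<Omega> p r a q1"
proof -
  have "herz_norm \<Omega> p r a q1 f \<le> herz_norm \<Omega> p r a q2 f" for f :: "'a \<Rightarrow> 'b"
    by (rule herz_norm_antimono_outer_index[OF assms])
  then show ?thesis
    unfolding embeds_def HL_def
    by (auto simp: herz_space_def intro: le_less_trans intro!: exI[of _ "1::real"])
qed

theorem theorem3p1p6:
  fixes \<Omega> :: "'a::euclidean_space set"
  assumes "\<Omega> \<in> sets lebesgue"
  shows
    "(\<forall>(a::real) (p::real) (r1::ennreal) (r2::ennreal) (q::ennreal).
        0 < p \<and> 0 < r1 \<and> r1 \<le> r2 \<and> 0 < q \<longrightarrow>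
        (HL \<Omega> (ennreal p) r1 a q :: ('a \<Rightarrow> 'b::real_normed_field) qn_space)
          \<hookrightarrow> HL \<Omega> (ennreal p) r2 a q) \<and>
     (\<forall>(a1::real) (a2::real) (p::ennreal) (q::ennreal) (r::ennreal).
        a2 \<le> a1 \<and> 0 < p \<and> 0 < q \<and> 0 < r \<and> (p = \<infinity> \<longrightarrow> r = \<infinity>) \<longrightarrow>
        (HL \<Omega> p r a1 q :: ('a \<Rightarrow> 'b) qn_space) \<hookrightarrow> HL \<Omega> p r a2 q) \<and>
     (emeasure lebesgue \<Omega> < \<infinity> \<longrightarrow>
      (\<forall>(a::real) (r1::ennreal) (r2::ennreal) (q::ennreal) (p1::real) (p2::real).
        0 < r1 \<and> 0 < r2 \<and> 0 < q \<and> 0 < p1 \<and> p1 < p2 \<longrightarrow>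
        (HL \<Omega> (ennreal p2) r2 a q :: ('a \<Rightarrow> 'b) qn_space)
          \<hookrightarrow> HL \<Omega> (ennreal p1) r1 a q)) \<and>
     (\<forall>(a::real) (r1::ennreal) (r2::ennreal) (q::ennreal) (p1::real) (p2::real).
        0 < r1 \<and> 0 < r2 \<and> 0 < q \<and> 0 < p1 \<and> p1 < p2 \<longrightarrow>
        (let p0 = 1 / p1 - 1 / p2 in
          0 < p0 \<and>
          (HL \<Omega> (ennreal p2) r2 (a + real DIM('a) * p0) q :: ('a \<Rightarrow> 'b) qn_space)
            \<hookrightarrow> HL \<Omega> (ennreal p1) r1 a q)) \<and>
     (\<forall>(a::real) (p::ennreal) (r::ennreal) (q1::ennreal) (q2::ennreal).
        0 < p \<and> 0 < r \<and> (p = \<infinity> \<longrightarrow> r = \<infinity>) \<and> 0 < q2 \<and> q2 \<le> q1 \<longrightarrow>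
        (HL \<Omega> p r a q2 :: ('a \<Rightarrow> 'b) qn_space) \<hookrightarrow> HL \<Omega> p r a q1)"
proof (intro conjI allI impI; (elim conjE)?)
  fix a p :: real and r1 r2 q :: ennreal
  assume "0 < r1" "r1 \<le> r2" "0 < q"
  then show "(HL \<Omega> (ennreal p) r1 a q :: ('a \<Rightarrow> 'b) qn_space) \<hookrightarrow> HL \<Omega> (ennreal p) r2 a q"
    by (rule HL_embeds_second_index)
next
  fix a1 a2 :: real and p q r :: ennreal
  assume "a2 \<le> a1" "0 < q"
  then show "(HL \<Omega> p r a1 q :: ('a \<Rightarrow> 'b) qn_space) \<hookrightarrow> HL \<Omega> p r a2 q"
    by (rule HL_embeds_weight)
next
  fix a p1 p2 :: real and r1 r2 q :: ennreal
  assume "emeasure lebesgue \<Omega> < \<infinity>" "0 < p1" "p1 < p2" "0 < r1" "0 < r2" "0 < q"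
  with assms show "(HL \<Omega> (ennreal p2) r2 a q :: ('a \<Rightarrow> 'b) qn_space) \<hookrightarrow> HL \<Omega> (ennreal p1) r1 a q"
    by (intro HL_embeds_first_index_finite_measure)
next
  fix a p1 p2 :: real and r1 r2 q :: ennreal
  assume p: "0 < p1" "p1 < p2" and "0 < r1" "0 < r2" "0 < q"
  then have "(HL \<Omega> (ennreal p2) r2 (a + real DIM('a) * (1 / p1 - 1 / p2)) q :: ('a \<Rightarrow> 'b) qn_space)
      \<hookrightarrow> HL \<Omega> (ennreal p1) r1 a q"
    by (intro HL_embeds_first_index[OF assms, where c = "unit_ball_vol (real DIM('a))"]
        emeasure_shell_le) auto
  moreover have "0 < 1 / p1 - 1 / p2"
    using p by (simp add: frac_less2)
  ultimately show "let p0 = 1 / p1 - 1 / p2 in 0 < p0 \<and>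
      (HL \<Omega> (ennreal p2) r2 (a + real DIM('a) * p0) q :: ('a \<Rightarrow> 'b) qn_space)
        \<hookrightarrow> HL \<Omega> (ennreal p1) r1 a q"
    by (simp add: Let_def)
next
  fix a :: real and p r q1 q2 :: ennreal
  assume "0 < q2" "q2 \<le> q1"
  then show "(HL \<Omega> p r a q2 :: ('a \<Rightarrow> 'b) qn_space) \<hookrightarrow> HL \<Omega> p r a q1"
    by (rule HL_embeds_outer_index)
qed

end
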